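(* Let $c\ge 1$ be an integer, and fix a realisation of the arrival times, service durations and residual workloads at time $T<0$, together with the associated FCFS sandwiching processes $U^{c'},L^{c'}$ on $[T,0]$ for all integers $c'\ge c$ (as defined in the context), such that $U^c$ and $L^c$ coalesce at time $T^c<0$. Suppose that any arrival time $\tau\in[T,T^c]$ satisfying $L^c_{\tau-}(1)=U^c_{\tau-}(1)$ (equivalently, $1\in\mathcal A^c_{\tau-}$) also satisfies $U^c_{\tau-}(1)=0$. Then $T^{c+m}\le T^c$ for every integer $m\ge 0$.
   Context: **Workload vectors.** For an integer $c'\ge1$, the Kiefer-Wolfowitz workload vector of a $c'$-server First Come First Served (FCFS) queue is a right-continuous process $V_t=(V_t(1),\dots,V_t(c'))$ with $0\le V_t(1)\le\dots\le V_t(c')$. It evolves deterministically given the arrivals. - Between arrivals every coordinate decreases at unit rate until it reaches $0$: if there is no arrival in $(s,t]$ then $V_t(k)=\max\{V_s(k)-(t-s),0\}$. - At an arrival time $\tau$ with associated service duration $S>0$, $V_\tau$ is obtained from the left limit $V_{\tau-}$ by adding $S$ to the first (smallest) coordinate $V_{\tau-}(1)$ and then reordering the coordinates in increasing order. **Sandwiching processes.** Fix $c\ge1$ and $T<0$. The data, viewed as a fixed realisation, are as follows. - A finite list $r_1,\dots,r_p>0$ ($p\ge0$) of residual workloads. These are the residual workloads of the jobs present at time $T$ in a stationary $M/G/c$ queue $Y$ with Random Assignment discipline (arrivals allocated to a uniformly chosen server), listed in order of initiation of service in $Y$. - The finitely many arrival times $T<\tau_1<\tau_2<\dots<\tau_N\le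 0$ in the window (distinct, as holds almost surely for Poisson arrivals), with associated service durations $S_1,\dots,S_N>0$. For each integer $c'\ge c$, two $c'$-server FCFS workload processes on $[T,0]$ are defined as follows. - The lower process $L^{c'}$ starts empty: $L^{c'}_T=(0,\dots,0)\in\mathbb R^{c'}$. - The upper process $U^{c'}$ starts from the vector $U^{c'}_T$ obtained from $(0,\dots,0)\in\mathbb R^{c'}$ by feeding in $r_1,\dots,r_p$ successively, all at time $T$: each $r_i$ is added to the current smallest coordinate, and the vector is then reordered increasingly. - Over $(T,0]$, both processes evolve by the FCFS dynamics above using the same arrivals $(\tau_i,S_i)$, $1\le i\le N$. **Notation.** $D^{c'}_t=U^{c'}_t-L^{c'}_t$ is the coordinatewise difference (it is non-negative). The coalescence time is $T^{c'}=\inf\{t>T: D^{c'}_t=0\}$, with $t$ ranging over $(T,0]$ and $\inf\emptyset=\infty$. The set of coordinates in agreement is $\mathcal A^{c'}_t=\{k: D^{c'}_t(k)=0,\ 1\le k\le c'\}$, and $\mathcal A^{c'}_{\tau-}$ is the same set computed from the left limits $U^{c'}_{\tau-},L^{c'}_{\tau-}$. *)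

theory Defs
  imports "HOL-Analysis.Analysis"
begin

text \<open>A workload vector with \<open>c\<close> coordinates is a list of length \<open>c\<close>; lists are indexed from 0,
  so the \<open>k\<close>-th coordinate \<open>V\<^sub>t(k)\<close> is \<open>V t ! (k - 1)\<close>, and the smallest
  coordinate \<open>V\<^sub>t(1)\<close> is \<open>V t ! 0\<close>.\<close>

definition add_job :: "real \<Rightarrow> real list \<Rightarrow> real list" where
  "add_job s v = sort (v[0 := v ! 0 + s])"

definition drain :: "real \<Rightarrow> real list \<Rightarrow> real list" where
  "drain d v = map (\<lambda>x. max (x - d) 0) v"

definition left_limit :: "nat \<Rightarrow> (real \<Rightarrow> real list) \<Rightarrow> real \<Rightarrow> real list" where
  "left_limit c V t = map (\<lambda>k. Lim (at_left t) (\<lambda>s. V s ! k)) [0..<c]"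

text \<open>\<open>V\<close> is a \<open>c\<close>-server FCFS workload process on \<open>[T, 0]\<close> started from \<open>v0\<close>, with arrival times
  \<open>\<tau> 1, \<dots>, \<tau> N\<close> and service durations \<open>S 1, \<dots>, S N\<close>. The values of \<open>V\<close> outside \<open>[T, 0]\<close>, and of
  \<open>\<tau>\<close> and \<open>S\<close> outside \<open>{1..N}\<close>, are irrelevant.\<close>

definition fcfs_process ::
  "nat \<Rightarrow> real \<Rightarrow> nat \<Rightarrow> (nat \<Rightarrow> real) \<Rightarrow> (nat \<Rightarrow> real) \<Rightarrow> real list \<Rightarrow> (real \<Rightarrow> real list) \<Rightarrow> bool"
where
  "fcfs_process c T N \<tau> S v0 V \<longleftrightarrow>
     V T = v0 \<and>
     (\<forall>t\<in>{T..0}. length (V t) = c \<and> sorted (V t) \<and> (\<forall>x\<in>set (V t). 0 \<le> x)) \<and>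
     (\<forall>t\<in>{T..<0}. \<forall>k<c. continuous (at_right t) (\<lambda>s. V s ! k)) \<and>
     (\<forall>s t. T \<le> s \<longrightarrow> s \<le> t \<longrightarrow> t \<le> 0 \<longrightarrow> (\<forall>i\<in>{1..N}. \<tau> i \<notin> {s<..t}) \<longrightarrow>
        V t = drain (t - s) (V s)) \<and>
     (\<forall>i\<in>{1..N}. V (\<tau> i) = add_job (S i) (left_limit c V (\<tau> i)))"

definition lower_init :: "nat \<Rightarrow> real list" where
  "lower_init c = replicate c 0"

definition upper_init :: "nat \<Rightarrow> real list \<Rightarrow> real list" where
  "upper_init c r = fold add_job r (replicate c 0)"

definition difference :: "(real \<Rightarrow> real list) \<Rightarrow> (real \<Rightarrow> real list) \<Rightarrow> real \<Rightarrow> real list" where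
  "difference U L t = map2 (-) (U t) (L t)"

text \<open>The infimum is taken in the extended reals, where \<open>Inf {} = \<infinity>\<close>.\<close>

definition coalescence_time ::
  "nat \<Rightarrow> real \<Rightarrow> (real \<Rightarrow> real list) \<Rightarrow> (real \<Rightarrow> real list) \<Rightarrow> ereal" where
  "coalescence_time c T U L =
     Inf (ereal ` {t. T < t \<and> t \<le> 0 \<and> difference U L t = replicate c 0})"


subsection \<open>Existence of the workload processes\<close>

lemma length_add_job [simp]: "length (add_job s v) = length v"
  by (simp add: add_job_def)

lemma sorted_add_job [simp]: "sorted (add_job s v)"
  by (simp add: add_job_def)

lemma nonneg_add_job:
  assumes "0 \<le> s" "\<forall>x\<in>set v. 0 \<le> x"
  shows "\<forall>x\<in>set (add_job s v). 0 \<le> x"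
proof (cases v)
  case Nil
  then show ?thesis by (simp add: add_job_def)
next
  case (Cons a w)
  then show ?thesis using assms by (auto simp: add_job_def set_insort_key)
qed

lemma length_drain [simp]: "length (drain d v) = length v"
  by (simp add: drain_def)

lemma nonneg_drain: "\<forall>x\<in>set (drain d v). 0 \<le> x"
  by (simp add: drain_def)

lemma sorted_drain: "sorted v \<Longrightarrow> sorted (drain d v)"
  unfolding drain_def sorted_map by (erule sorted_wrt_mono_rel[rotated]) auto

lemma drain_drain: "0 \<le> d \<Longrightarrow> 0 \<le> e \<Longrightarrow> drain d (drain e v) = drain (d + e) v"
  by (auto simp: drain_def max_def)

lemma drain_0: "\<forall>x\<in>set v. 0 \<le> x \<Longrightarrow> drain 0 v = v"
  by (simp add: drain_def map_idI)

primrec fcfs_path ::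
  "real \<Rightarrow> (nat \<Rightarrow> real) \<Rightarrow> (nat \<Rightarrow> real) \<Rightarrow> real list \<Rightarrow> nat \<Rightarrow> real \<Rightarrow> real list" where
  "fcfs_path T \<tau> S v0 0 t = drain (t - T) v0"
| "fcfs_path T \<tau> S v0 (Suc n) t =
     (if t < \<tau> (Suc n) then fcfs_path T \<tau> S v0 n t
      else drain (t - \<tau> (Suc n)) (add_job (S (Suc n)) (fcfs_path T \<tau> S v0 n (\<tau> (Suc n)))))"

lemma left_limit_cong:
  assumes "a < t" "\<And>s. a \<le> s \<Longrightarrow> s < t \<Longrightarrow> V s = W s"
  shows "left_limit c V t = left_limit c W t"
proof -
  have ev: "eventually (\<lambda>s. V s = W s) (at_left t)"
    using eventually_at_left_real[OF assms(1)] by eventually_elim (use assms in auto)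
  have "((\<lambda>s. V s ! k) \<longlongrightarrow> l) (at_left t) \<longleftrightarrow> ((\<lambda>s. W s ! k) \<longlongrightarrow> l) (at_left t)" for k l
    by (rule tendsto_cong, use ev in eventually_elim) simp
  then show ?thesis by (simp add: left_limit_def t2_space_class.Lim_def)
qed

lemma left_limit_drain:
  assumes "a < t" "length v = c" "\<And>s. a \<le> s \<Longrightarrow> s < t \<Longrightarrow> V s = drain (s - a) v"
  shows "left_limit c V t = drain (t - a) v"
proof -
  have "left_limit c V t = left_limit c (\<lambda>s. drain (s - a) v) t"
    by (rule left_limit_cong[OF assms(1)]) (use assms in auto)
  also have "\<dots> = drain (t - a) v"
  proof (rule nth_equalityI)
    fix k assume "k < length (left_limit c (\<lambda>s. drain (s - a) v) t)"
    then have k: "k < c" by (simp add: left_limit_def)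
    have "((\<lambda>s. max (v ! k - (s - a)) 0) \<longlongrightarrow> max (v ! k - (t - a)) 0) (at_left t)"
      by (intro tendsto_intros)
    then show "left_limit c (\<lambda>s. drain (s - a) v) t ! k = drain (t - a) v ! k"
      using k assms(2) by (simp add: left_limit_def drain_def tendsto_Lim)
  qed (simp add: left_limit_def assms)
  finally show ?thesis .
qed

lemma fcfs_right_continuous:
  fixes N :: nat
  assumes len: "\<forall>t\<in>{T..0}. length (V t) = c"
    and nonneg: "\<forall>t\<in>{T..0}. \<forall>x\<in>set (V t). 0 \<le> x"
    and drn: "\<forall>s t. T \<le> s \<longrightarrow> s \<le> t \<longrightarrow> t \<le> 0 \<longrightarrow> (\<forall>i\<in>{1..N}. \<tau> i \<notin> {s<..t}) \<longrightarrow>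
        V t = drain (t - s) (V s)"
    and t: "t \<in> {T..<0}" and k: "k < c"
  shows "continuous (at_right t) (\<lambda>s. V s ! k)"
proof -
  define b where "b = Min (insert 0 (\<tau> ` {i \<in> {1..N}. t < \<tau> i}))"
  have fin: "finite (insert 0 (\<tau> ` {i \<in> {1..N}. t < \<tau> i}))" by simp
  have "t < b"
    unfolding b_def using t by (subst Min_gr_iff) auto
  moreover have "b \<le> 0"
    unfolding b_def by (rule Min_le[OF fin]) simp
  moreover have "b \<le> \<tau> i" if "i \<in> {1..N}" "t < \<tau> i" for i
    unfolding b_def by (rule Min_le[OF fin]) (use that in simp)
  ultimately have b: "t < b" "b \<le> 0" "\<And>i. i \<in> {1..N} \<Longrightarrow> t < \<tau> i \<Longrightarrow> b \<le> \<tau> i" by blast+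
  have "eventually (\<lambda>s. drain (s - t) (V t) ! k = V s ! k) (at_right t)"
    using eventually_at_right_real[OF b(1)]
  proof eventually_elim
    case (elim s)
    then have s: "T \<le> t" "t \<le> s" "s \<le> 0" using t b(2) by auto
    have "\<forall>i\<in>{1..N}. \<tau> i \<notin> {t<..s}"
    proof (intro ballI notI)
      fix i assume "i \<in> {1..N}" "\<tau> i \<in> {t<..s}"
      then show False using b(3)[of i] elim by simp
    qed
    then have "V s = drain (s - t) (V t)" using drn s by blast
    then show ?case by (rule arg_cong[OF sym])
  qed
  moreover have "((\<lambda>s. drain (s - t) (V t) ! k) \<longlongrightarrow> V t ! k) (at_right t)"
  proof -
    have "((\<lambda>s. max (V t ! k - (s - t)) 0) \<longlongrightarrow> max (V t ! k - (t - t)) 0) (at_right t)"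
      by (intro tendsto_intros)
    moreover have kl: "k < length (V t)" using len t k by simp
    moreover have "V t ! k \<ge> 0" using nonneg[rule_format, OF _ nth_mem[OF kl]] t by simp
    ultimately show ?thesis by (simp add: drain_def)
  qed
  ultimately show ?thesis
    unfolding continuous_within by (rule Lim_transform_eventually[rotated])
qed

lemma fcfs_process_exists:
  assumes "T < 0" "strict_mono_on {1..N} \<tau>" "\<forall>i\<in>{1..N}. T < \<tau> i \<and> \<tau> i \<le> 0 \<and> 0 < S i"
    and v0: "length v0 = c" "sorted v0" "\<forall>x\<in>set v0. 0 \<le> x"
  shows "fcfs_process c T N \<tau> S v0 (fcfs_path T \<tau> S v0 N)"
  using assms(2,3)
proof (induction N)
  case 0
  define V where "V = fcfs_path T \<tau> S v0 0"
  have V: "V t = drain (t - T) v0" for t by (simp add: V_def)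
  have V1: "\<forall>t\<in>{T..0}. length (V t) = c \<and> sorted (V t) \<and> (\<forall>x\<in>set (V t). 0 \<le> x)"
    unfolding V using v0 sorted_drain nonneg_drain by simp
  have V2: "\<forall>s t. T \<le> s \<longrightarrow> s \<le> t \<longrightarrow> t \<le> 0 \<longrightarrow> (\<forall>i\<in>{1..0}. \<tau> i \<notin> {s<..t}) \<longrightarrow>
      V t = drain (t - s) (V s)"
    unfolding V by (simp add: drain_drain)
  have V3: "\<forall>t\<in>{T..<0}. \<forall>k<c. continuous (at_right t) (\<lambda>s. V s ! k)"
  proof (intro ballI allI impI)
    show "continuous (at_right t) (\<lambda>s. V s ! k)" if "t \<in> {T..<0}" "k < c" for t k
      by (rule fcfs_right_continuous[OF _ _ V2 that]) (use V1 in auto)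
  qed
  have "V T = v0" unfolding V using v0 by (simp add: drain_0)
  then have "fcfs_process c T 0 \<tau> S v0 V"
    unfolding fcfs_process_def by (intro conjI V1 V2 V3) (assumption, simp)
  then show ?case by (simp only: V_def)
next
  case (Suc n)
  define V where "V = fcfs_path T \<tau> S v0 n"
  define W where "W = fcfs_path T \<tau> S v0 (Suc n)"
  define u where "u = \<tau> (Suc n)"
  have W: "W t = (if t < u then V t else drain (t - u) (add_job (S (Suc n)) (V u)))" for t
    by (simp add: W_def V_def u_def)
  have mono: "\<tau> i < u" if "i \<in> {1..n}" for i
    using strict_mono_onD[OF Suc.prems(1), of i "Suc n"] that by (auto simp: u_def)
  have u: "T < u" "u \<le> 0" "0 < S (Suc n)" using Suc.prems(2) by (auto simp: u_def)
  have "strict_mono_on {1..n} \<tau>"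
    using Suc.prems(1) by (auto simp: monotone_on_def)
  then have IH: "fcfs_process c T n \<tau> S v0 V"
    unfolding V_def by (rule Suc.IH) (intro ballI Suc.prems(2)[rule_format], simp)
  have VT: "V T = v0"
    and V1': "\<forall>t\<in>{T..0}. length (V t) = c \<and> sorted (V t) \<and> (\<forall>x\<in>set (V t). 0 \<le> x)"
    and V2': "\<forall>s t. T \<le> s \<longrightarrow> s \<le> t \<longrightarrow> t \<le> 0 \<longrightarrow> (\<forall>i\<in>{1..n}. \<tau> i \<notin> {s<..t}) \<longrightarrow>
        V t = drain (t - s) (V s)"
    and V3': "\<forall>i\<in>{1..n}. V (\<tau> i) = add_job (S i) (left_limit c V (\<tau> i))"
    using IH[unfolded fcfs_process_def] by - (elim conjE, assumption)+
  have V1: "length (V t) = c \<and> sorted (V t) \<and> (\<forall>x\<in>set (V t). 0 \<le> x)" if "T \<le> t" "t \<le> 0" for t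
    using V1' that by simp
  have V2: "V t = drain (t - s) (V s)"
    if "T \<le> s" "s \<le> t" "t \<le> 0" "\<forall>i\<in>{1..n}. \<tau> i \<notin> {s<..t}" for s t
    by (rule V2'[rule_format, OF that(1-3)]) (use that(4) in blast)
  have V3: "V (\<tau> i) = add_job (S i) (left_limit c V (\<tau> i))" if "i \<in> {1..n}" for i
    using V3' that by blast
  define a where "a = Max (insert T (\<tau> ` {1..n}))"
  have a: "T \<le> a" "a < u" "\<And>i. i \<in> {1..n} \<Longrightarrow> \<tau> i \<le> a"
  proof -
    have fin: "finite (insert T (\<tau> ` {1..n}))" by simp
    show "T \<le> a" unfolding a_def by (rule Max_ge[OF fin]) simp
    show "a < u" unfolding a_def using u mono by (subst Max_less_iff) auto
    show "\<tau> i \<le> a" if "i \<in> {1..n}" for i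
      unfolding a_def by (rule Max_ge[OF fin]) (use that in simp)
  qed
  have Va: "V s = drain (s - a) (V a)" if "a \<le> s" "s \<le> u" for s
  proof (rule V2)
    show "\<forall>i\<in>{1..n}. \<tau> i \<notin> {a<..s}"
      using a(3) by (meson greaterThanAtMost_iff leD)
  qed (use a(1,2) u(2) that in linarith)+
  have WT: "W T = v0" using VT u by (simp add: W)
  have W1: "\<forall>t\<in>{T..0}. length (W t) = c \<and> sorted (W t) \<and> (\<forall>x\<in>set (W t). 0 \<le> x)"
  proof
    fix t assume "t \<in> {T..0}"
    then show "length (W t) = c \<and> sorted (W t) \<and> (\<forall>x\<in>set (W t). 0 \<le> x)"
      using V1[of t] V1[of u] u nonneg_drain by (simp add: W sorted_drain)
  qed
  have W2: "W t = drain (t - s) (W s)"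
    if "T \<le> s" "s \<le> t" "t \<le> 0" "\<forall>i\<in>{1..Suc n}. \<tau> i \<notin> {s<..t}" for s t
  proof (cases "t < u")
    case True
    have "\<forall>i\<in>{1..n}. \<tau> i \<notin> {s<..t}" using that(4) by simp
    from V2[OF that(1-3) this] show ?thesis using True that(2) unfolding W by simp
  next
    case False
    moreover have "u \<notin> {s<..t}" using that(4) by (auto simp: u_def)
    ultimately have "u \<le> s" by auto
    then show ?thesis using that by (simp add: W drain_drain)
  qed
  have W3: "W (\<tau> i) = add_job (S i) (left_limit c W (\<tau> i))" if i: "i \<in> {1..Suc n}" for i
  proof (cases "i = Suc n")
    case True
    have "left_limit c W u = drain (u - a) (V a)"
    proof (rule left_limit_drain)
      show "length (V a) = c" using V1[of a] a u by simp
      show "W s = drain (s - a) (V a)" if "a \<le> s" "s < u" for s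
        using Va[of s] that by (simp add: W)
    qed (rule a)
    also have "\<dots> = V u" using Va[of u] a(2) by simp
    finally have *: "left_limit c W u = V u" .
    have "\<forall>x\<in>set (add_job (S (Suc n)) (V u)). 0 \<le> x"
      by (rule nonneg_add_job) (use u V1[of u] in auto)
    then show ?thesis
      using True * by (simp add: W u_def[symmetric] drain_0)
  next
    case False
    then have i': "i \<in> {1..n}" using i by auto
    have "left_limit c W (\<tau> i) = left_limit c V (\<tau> i)"
    proof (rule left_limit_cong)
      show "T < \<tau> i" using Suc.prems(2) i by blast
      show "W s = V s" if "s < \<tau> i" for s using mono[OF i'] that by (simp add: W)
    qed
    moreover have "W (\<tau> i) = V (\<tau> i)" using mono[OF i'] by (simp add: W)
    ultimately show ?thesis using V3[OF i'] by (simp only:)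
  qed
  have W2': "\<forall>s t. T \<le> s \<longrightarrow> s \<le> t \<longrightarrow> t \<le> 0 \<longrightarrow> (\<forall>i\<in>{1..Suc n}. \<tau> i \<notin> {s<..t}) \<longrightarrow>
      W t = drain (t - s) (W s)"
    by (intro allI impI) (rule W2)
  have W3': "\<forall>i\<in>{1..Suc n}. W (\<tau> i) = add_job (S i) (left_limit c W (\<tau> i))"
    by (intro ballI) (rule W3)
  have W4: "\<forall>t\<in>{T..<0}. \<forall>k<c. continuous (at_right t) (\<lambda>s. W s ! k)"
  proof (intro ballI allI impI)
    show "continuous (at_right t) (\<lambda>s. W s ! k)" if "t \<in> {T..<0}" "k < c" for t k
      by (rule fcfs_right_continuous[OF _ _ W2' that]) (use W1 in auto)
  qed
  have "fcfs_process c T (Suc n) \<tau> S v0 W"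
    unfolding fcfs_process_def by (intro conjI WT W1 W2' W3' W4)
  then show ?case by (simp only: W_def)
qed

lemma lower_init_valid:
  "length (lower_init c) = c \<and> sorted (lower_init c) \<and> (\<forall>x\<in>set (lower_init c). 0 \<le> x)"
  by (simp add: lower_init_def)

lemma upper_init_valid:
  assumes "\<forall>x\<in>set r. 0 < x"
  shows "length (upper_init c r) = c \<and> sorted (upper_init c r) \<and> (\<forall>x\<in>set (upper_init c r). 0 \<le> x)"
  using assms
proof (induction r rule: rev_induct)
  case Nil
  then show ?case by (simp add: upper_init_def)
next
  case (snoc s r)
  then have IH: "length (upper_init c r) = c" "\<forall>x\<in>set (upper_init c r). 0 \<le> x" by auto
  have "upper_init c (r @ [s]) = add_job s (upper_init c r)" by (simp add: upper_init_def)
  moreover have "\<forall>x\<in>set (add_job s (upper_init c r)). 0 \<le> x"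
    by (rule nonneg_add_job) (use snoc.prems IH in auto)
  ultimately show ?case using IH by simp
qed

end

theory Submission
  imports Defs
begin

text \<open>Follow the departure time of every job. If the two processes agree at a time when a server is
  idle, comparing total workloads shows that every job still present has the same departure time in
  the lower and the upper process. By the agreement hypothesis such a job found an idle server on
  arrival in the upper process, so by monotonicity it starts at once in all processes with at least
  as many servers, and it departs at the same time there too. An arrival cannot cause coalescence,
  because it leaves the total difference unchanged; hence coalescence is caused by draining, and a
  server of the upper process is idle at that moment.\<close>

section \<open>Clock vectors, draining and arrivals\<close>

text \<open>The vector after \<open>n\<close> jobs, in absolute time: server \<open>k\<close> becomes free at time \<open>clock \<dots> ! k\<close>,
  and the workload vector at time \<open>t\<close> is \<open>drain t (clock \<dots>)\<close>.\<close>

primrec clock :: "nat \<Rightarrow> real \<Rightarrow> (nat \<Rightarrow> real) \<Rightarrow> (nat \<Rightarrow> real) \<Rightarrow> nat \<Rightarrow> real list" where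
  "clock c T a s 0 = replicate c T"
| "clock c T a s (Suc n) =
     insort (max (clock c T a s n ! 0) (a n) + s n) (tl (clock c T a s n))"

definition departure ::
  "nat \<Rightarrow> real \<Rightarrow> (nat \<Rightarrow> real) \<Rightarrow> (nat \<Rightarrow> real) \<Rightarrow> nat \<Rightarrow> real" where
  "departure c T a s n = max (clock c T a s n ! 0) (a n) + s n"

lemma length_clock [simp]: "1 \<le> c \<Longrightarrow> length (clock c T a s n) = c"
  by (induction n) auto

lemma sorted_clock [simp]: "sorted (clock c T a s n)"
  by (induction n) (auto simp: sorted_insort sorted_tl)

lemma clock_Cons:
  assumes "1 \<le> c"
  obtains w where "clock c T a s n = clock c T a s n ! 0 # w"
  using length_clock[OF assms, of T a s n] assms
  by (cases "clock c T a s n") auto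

lemma drain_nth: "k < length w \<Longrightarrow> drain t w ! k = max (w ! k - t) 0"
  by (simp add: drain_def)

text \<open>Clipping at time \<open>s\<close> affects only servers free by \<open>s\<close>, and
  these stay clipped later. Elapsed-time draining can thus be read off the clock vector at absolute
  time.\<close>

lemma drain_diff:
  assumes "s \<le> t"
  shows "drain (t - s) (drain s w) = drain t w"
  using assms by (auto simp: drain_def max_def)

lemma drain_eq_mono: "drain s v = drain s w \<Longrightarrow> s \<le> t \<Longrightarrow> drain t v = drain t w"
  by (metis drain_diff)

lemma drain_insort: "drain t (insort x w) = insort (max (x - t) 0) (drain t w)"
proof (induction w)
  case (Cons y w)
  \<comment> \<open>Two distinct entries may both clip to 0 and so change the insertion point; this
    fact shows that the resulting lists still coincide.\<close>
  have "insort 0 (drain t w) = 0 # drain t w"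
    by (rule insort_is_Cons) (use nonneg_drain in blast)
  with Cons show ?case by (auto simp: drain_def max_def)
qed (simp add: drain_def)

lemma add_job_Cons: "sorted (x # v) \<Longrightarrow> add_job s (x # v) = insort (x + s) v"
  by (simp add: add_job_def sorted_sort_id)

text \<open>With \<open>x\<close> the smallest clock entry, the job waits
  \<open>max (x - a n) 0\<close> and so completes at \<open>max x (a n) + s n\<close>, the entry
  that \<open>clock\<close> inserts. As \<open>s n\<close> is non-negative, clipping at
  \<open>a n\<close> leaves this entry alone.\<close>

lemma add_job_drain:
  assumes "1 \<le> c" "0 \<le> s n"
  shows "add_job (s n) (drain (a n) (clock c T a s n)) = drain (a n) (clock c T a s (Suc n))"
proof -
  obtain w where w: "clock c T a s n = clock c T a s n ! 0 # w" (is "_ = ?x # _")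
    using clock_Cons[OF assms(1)] .
  have "sorted (drain (a n) (?x # w))"
    using sorted_drain[OF sorted_clock, of "a n" c T a s n] w by simp
  then have "add_job (s n) (drain (a n) (?x # w)) = insort (max (?x - a n) 0 + s n) (drain (a n) w)"
    by (simp add: drain_def add_job_Cons)
  also have "max (?x - a n) 0 + s n = max (max ?x (a n) + s n - a n) 0"
    using assms(2) by auto
  also have "insort \<dots> (drain (a n) w) = drain (a n) (clock c T a s (Suc n))"
    by (metis clock.simps(2) drain_insort list.sel(3) w)
  finally show ?thesis using w by simp
qed

section \<open>Comparison of ordered workload vectors\<close>

lemma sum_list_insort: "sum_list (insort x w) = x + sum_list (w :: real list)"
  by (induction w) auto

lemma sum_list_add_job:
  assumes "sorted v" "v \<noteq> []"
  shows "sum_list (add_job s v) = s + sum_list v"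
  using assms by (cases v) (auto simp: add_job_Cons sum_list_insort)

lemma list_eq_of_le_of_sum_list_eq:
  fixes v w :: "real list"
  assumes "list_all2 (\<le>) v w" "sum_list v = sum_list w"
  shows "v = w"
  using assms
proof (induction rule: list_all2_induct)
  case (Cons x v y w)
  have "sum_list v \<le> sum_list w"
    using Cons.hyps(2) by (induction rule: list_all2_induct) auto
  then show ?case using Cons by simp
qed simp

text \<open>The first argument is meant for the system with more servers; its surplus, largest
  coordinates are left unconstrained.\<close>

definition prefix_le :: "real list \<Rightarrow> real list \<Rightarrow> bool" where
  "prefix_le v w \<longleftrightarrow> length w \<le> length v \<and> (\<forall>k<length w. v ! k \<le> w ! k)"

lemma prefix_le_Nil [simp]: "prefix_le v []"
  by (simp add: prefix_le_def)

lemma prefix_le_Cons: "prefix_le (x # v) (y # w) \<longleftrightarrow> x \<le> y \<and> prefix_le v w"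
  by (auto simp: prefix_le_def less_Suc_eq_0_disj)

lemma prefix_le_insort:
  assumes "prefix_le v w" "sorted v" "sorted w" "x \<le> y"
  shows "prefix_le (insort x v) (insort y w)"
  using assms
proof (induction w arbitrary: v x y)
  case Nil
  then show ?case by (cases v) (auto simp: prefix_le_Cons)
next
  case (Cons b w)
  then obtain a v' where v: "v = a # v'"
    by (cases v) (auto simp: prefix_le_def)
  then have ab: "a \<le> b" and le: "prefix_le v' w"
    using Cons.prems(1) by (auto simp: prefix_le_Cons)
  have sv: "sorted v'" "insort a v' = a # v'" and sw: "sorted w" "insort b w = b # w"
    using Cons.prems v by (auto simp: insort_is_Cons)
  have IH: "prefix_le (insort x' v') (insort y' w)" if "x' \<le> y'" for x' y'
    using Cons.IH[OF le sv(1) sw(1) that] .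
  \<comment> \<open>When exactly one of the two insertions stops at the head, the old head counts as
    inserted into the tail: \<open>a\<close> against \<open>y\<close>, or \<open>x\<close> against
    \<open>b\<close>. These are the mixed instances of the induction hypothesis.\<close>
  show ?case
    using ab le Cons.prems(4) IH[of a y] IH[of x b] IH[of x y] sv(2) sw(2)
    by (auto simp: v prefix_le_Cons)
qed

text \<open>Serving a job replaces the minimum by a quantity monotone in that minimum and in the
  duration, and insertion preserves the order. Varying servers and durations together covers both
  the sandwiching and the passage to more servers.\<close>

lemma prefix_le_clock:
  assumes "1 \<le> c" "c \<le> c'" "\<And>j. j < n \<Longrightarrow> s j \<le> s' j"
  shows "prefix_le (clock c' T a s n) (clock c T a s' n)"
  using assms(3)
proof (induction n)
  case 0
  then show ?case using assms(1,2) by (simp add: prefix_le_def)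
next
  case (Suc n)
  obtain v where v: "clock c' T a s n = clock c' T a s n ! 0 # v" (is "_ = ?x # _")
    using clock_Cons assms(1,2) by (metis le_trans)
  obtain w where w: "clock c T a s' n = clock c T a s' n ! 0 # w" (is "_ = ?y # _")
    using clock_Cons assms(1) by metis
  have IH: "prefix_le (?x # v) (?y # w)" using Suc v w by auto
  have "sorted (?x # v)" "sorted (?y # w)" using v w sorted_clock by metis+
  then have "prefix_le (insort (max ?x (a n) + s n) v) (insort (max ?y (a n) + s' n) w)"
    using IH Suc.prems[of n] by (intro prefix_le_insort) (auto simp: prefix_le_Cons)
  then show ?case by (metis clock.simps(2) list.sel(3) v w)
qed

lemma clock_hd_le:
  assumes "1 \<le> c" "c \<le> c'" "\<And>j. j < n \<Longrightarrow> s j \<le> s' j"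
  shows "clock c' T a s n ! 0 \<le> clock c T a s' n ! 0"
  using prefix_le_clock[OF assms] assms(1) by (auto simp: prefix_le_def)

lemma departure_le:
  assumes "1 \<le> c" "c \<le> c'" "\<And>j. j \<le> n \<Longrightarrow> s j \<le> s' j"
  shows "departure c' T a s n \<le> departure c T a s' n"
  using clock_hd_le[of c c' n s s' T a] assms(3)[of n] assms(1,2) assms(3)
  unfolding departure_def by (force intro: add_mono max.mono)

lemma list_all2_drain_clock:
  assumes "1 \<le> c" "\<And>j. j < n \<Longrightarrow> s j \<le> s' j"
  shows "list_all2 (\<le>) (drain t (clock c T a s n)) (drain t (clock c T a s' n))"
proof -
  have "clock c T a s n ! k \<le> clock c T a s' n ! k" if "k < c" for k
    using prefix_le_clock[of c c n s s' T a] assms that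
    by (auto simp: prefix_le_def)
  then show ?thesis
    using assms(1) by (force simp: list_all2_conv_all_nth drain_nth)
qed

lemma drain_clock_eqI:
  assumes "1 \<le> c" "\<And>j. j < n \<Longrightarrow> s j \<le> s' j"
    "sum_list (drain t (clock c T a s n)) = sum_list (drain t (clock c T a s' n))"
  shows "drain t (clock c T a s n) = drain t (clock c T a s' n)"
  by (rule list_eq_of_le_of_sum_list_eq[OF list_all2_drain_clock]) (use assms in auto)

section \<open>Total workload through departure times\<close>

lemma clock_hd_mono:
  assumes "1 \<le> c" "0 \<le> s n"
  shows "clock c T a s n ! 0 \<le> clock c T a s (Suc n) ! 0"
proof -
  obtain w where w: "clock c T a s n = clock c T a s n ! 0 # w" (is "_ = ?x # _")
    using clock_Cons assms(1) by metis
  have "sorted (?x # w)" using w sorted_clock by metis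
  moreover have "clock c T a s (Suc n) = insort (max ?x (a n) + s n) w"
    by (metis clock.simps(2) list.sel(3) w)
  ultimately show ?thesis
    using assms(2) by (cases w) auto
qed

text \<open>A completion time leaves the clock vector only as its minimum, so once the minimum is at most
  \<open>t\<close> the vector still records every job that departs after \<open>t\<close>.\<close>

lemma sum_list_drain_clock:
  assumes "1 \<le> c" "\<And>j. j < n \<Longrightarrow> 0 \<le> s j" "clock c T a s n ! 0 \<le> t"
  shows "sum_list (drain t (clock c T a s n)) = (\<Sum>j<n. max (departure c T a s j - t) 0)"
  using assms(2,3)
proof (induction n)
  case 0
  then show ?case using assms(1) by (simp add: drain_def sum_list_replicate)
next
  case (Suc n)
  obtain w where w: "clock c T a s n = clock c T a s n ! 0 # w" (is "_ = ?x # _")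
    using clock_Cons assms(1) by metis
  have x: "?x \<le> t"
    using clock_hd_mono[of c s n T a] assms(1) Suc.prems by force
  have "clock c T a s (Suc n) = insort (departure c T a s n) w"
    unfolding departure_def by (metis clock.simps(2) list.sel(3) w)
  then have "sum_list (drain t (clock c T a s (Suc n))) =
      max (departure c T a s n - t) 0 + sum_list (drain t w)"
    by (simp add: drain_insort sum_list_insort)
  also have "sum_list (drain t w) = sum_list (drain t (?x # w))"
    using x by (simp add: drain_def)
  also have "\<dots> = (\<Sum>j<n. max (departure c T a s j - t) 0)"
    using Suc.IH x Suc.prems(1) w by simp
  finally show ?case by simp
qed

section \<open>Coalescence of the coupled systems\<close>

text \<open>The jobs \<open>j < p\<close> are the residual workloads, served from time \<open>T\<close> with durations \<open>s' j\<close> in the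
  upper process. In the lower process they have duration \<open>0\<close>, which leaves the clock vector at
  its initial value.\<close>

locale coupled_jobs =
  fixes T :: real and a s s' :: "nat \<Rightarrow> real" and p :: nat
  assumes a_ge: "T \<le> a j" and a_mono: "mono a"
    and s_nonneg: "0 \<le> s j"
    and s_less: "j < p \<Longrightarrow> a j = T \<and> s j = 0 \<and> 0 < s' j"
    and s_eq: "p \<le> j \<Longrightarrow> s' j = s j"
begin

lemma s_le: "s j \<le> s' j" and s'_nonneg: "0 \<le> s' j"
  using s_less[of j] s_eq[of j] s_nonneg[of j] by (cases "j < p"; simp)+

lemma clock_initial:
  assumes "1 \<le> c" "n \<le> p"
  shows "clock c T a s n = replicate c T"
  using assms(2)
proof (induction n)
  case (Suc n)
  then show ?case
    using assms(1) s_less[of n] by (cases c) (auto simp: insort_is_Cons)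
qed simp

definition coalesced :: "nat \<Rightarrow> nat \<Rightarrow> real \<Rightarrow> bool" where
  "coalesced c n t \<longleftrightarrow> drain t (clock c T a s n) = drain t (clock c T a s' n)"

lemma coalesced_mono: "coalesced c n t \<Longrightarrow> t \<le> u \<Longrightarrow> coalesced c n u"
  unfolding coalesced_def by (rule drain_eq_mono)

text \<open>The lower vector lies coordinatewise below the upper one, so they agree exactly when
  their totals do, and the job adds \<open>s n\<close> to both totals.\<close>

lemma coalesced_Suc_iff:
  assumes "1 \<le> c" "p \<le> n"
  shows "coalesced c (Suc n) (a n) \<longleftrightarrow> coalesced c n (a n)"
proof -
  have eq: "add_job (s n) (drain (a n) (clock c T a s n)) = drain (a n) (clock c T a s (Suc n))"
      "add_job (s n) (drain (a n) (clock c T a s' n)) = drain (a n) (clock c T a s' (Suc n))"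
    using add_job_drain[OF assms(1), of s] add_job_drain[OF assms(1), of s'] s_nonneg
      s_eq[OF assms(2)] by metis+
  have "sum_list (add_job (s n) (drain (a n) (clock c T a z n))) =
      s n + sum_list (drain (a n) (clock c T a z n))" for z
  proof (rule sum_list_add_job)
    show "drain (a n) (clock c T a z n) \<noteq> []"
      using assms(1) by (metis length_clock length_drain list.size(3) not_one_le_zero)
  qed (simp add: sorted_drain)
  then show ?thesis
    unfolding coalesced_def
    using eq drain_clock_eqI[of c n s s' "a n" T a] assms(1) s_le
    by (metis add_left_cancel)
qed

text \<open>Coalescence survives draining by \<open>coalesced_mono\<close> and arrivals by
  \<open>coalesced_Suc_iff\<close>. The side conditions place the arrivals of jobs \<open>n\<close>
  to \<open>m - 1\<close> in \<open>[t, u]\<close>; they are guarded because for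
  \<open>n = m\<close> there is only draining.\<close>

lemma coalesced_later:
  assumes "1 \<le> c" "p \<le> n" "n \<le> m" "coalesced c n t" "t \<le> u" "n < m \<Longrightarrow> t \<le> a n"
    "n < m \<Longrightarrow> a (m - 1) \<le> u"
  shows "coalesced c m u"
  using assms(3,5,6,7)
proof (induction arbitrary: u rule: dec_induct)
  case base
  then show ?case using assms(4) coalesced_mono by blast
next
  case (step m)
  have am: "a n \<le> a m" using step.hyps a_mono by (simp add: monoD)
  have "coalesced c m (a m)"
  proof (rule step.IH)
    show "a (m - 1) \<le> a m" using a_mono by (simp add: monoD)
  qed (use step am in auto)
  then have "coalesced c (Suc m) (a m)"
    using coalesced_Suc_iff[of c m] assms(1,2) step.hyps by simp
  then show ?case
    by (rule coalesced_mono) (use step in simp)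
qed

text \<open>With an idle server, every job still present under \<open>s'\<close> departs at the same time under \<open>s\<close>.
  Such a job started immediately, and hence does so with any larger number of servers.\<close>

lemma coalesced_more_servers_idle:
  assumes "1 \<le> c" "c \<le> c'" and coal: "coalesced c n t"
    and idle: "clock c T a s' n ! 0 \<le> t" and t: "T \<le> t"
    and agree: "\<And>j. p \<le> j \<Longrightarrow> j < n \<Longrightarrow>
      max (clock c T a s j ! 0) (a j) = max (clock c T a s' j ! 0) (a j) \<Longrightarrow>
      clock c T a s' j ! 0 \<le> a j"
  shows "coalesced c' n t"
proof -
  have c': "1 \<le> c'" using assms(1,2) by simp
  have idles: "clock c T a s n ! 0 \<le> t" "clock c' T a s n ! 0 \<le> t" "clock c' T a s' n ! 0 \<le> t"
    using clock_hd_le[of c c n s s' T a] clock_hd_le[of c c' n s s' T a]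
      clock_hd_le[of c c' n s' s' T a] assms(1,2) idle s_le by fastforce+
  \<comment> \<open>Both \<open>c\<close>-server systems have an idle server at \<open>t\<close>, so
    their equal totals are sums of clipped departure times; monotonicity then forces equality term
    by term.\<close>
  have "(\<Sum>j<n. max (departure c T a s j - t) 0) = (\<Sum>j<n. max (departure c T a s' j - t) 0)"
    using coal sum_list_drain_clock[of c n s T a t] sum_list_drain_clock[of c n s' T a t]
      assms(1) idle idles(1) s_nonneg s'_nonneg unfolding coalesced_def by simp
  then have "(\<Sum>j<n. max (departure c T a s' j - t) 0 - max (departure c T a s j - t) 0) = 0"
    by (simp add: sum_subtractf)
  moreover have le: "departure c T a s j \<le> departure c T a s' j" for j
    by (rule departure_le) (use assms(1) s_le in auto)
  ultimately have eq: "max (departure c T a s' j - t) 0 = max (departure c T a s j - t) 0"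
    if "j < n" for j
    using sum_nonneg_0[of "{..<n}"
        "\<lambda>j. max (departure c T a s' j - t) 0 - max (departure c T a s j - t) 0" j] that
    by (simp add: max.coboundedI1)
  have "max (departure c' T a s j - t) 0 = max (departure c' T a s' j - t) 0" if j: "j < n" for j
  \<comment> \<open>A job gone by \<open>t\<close> from the upper \<open>c\<close>-server system is
    gone from both \<open>c'\<close>-server systems. For a job still present, clipping is inactive
    and the departure times themselves agree.\<close>
  proof (cases "departure c T a s' j \<le> t")
    case True
    have "departure c' T a s' j \<le> departure c T a s' j" "departure c' T a s j \<le> departure c T a s' j"
      by (rule departure_le; use assms(1,2) s_le in auto)+
    then show ?thesis using True by simp
  next
    case False
    then have dep: "departure c T a s j = departure c T a s' j"
      using eq[OF j] by (auto simp: max_def split: if_splits)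
    \<comment> \<open>A residual job has duration 0 in the lower system and leaves it at
      \<open>T\<close>, so it cannot share a departure time beyond \<open>t\<close>.\<close>
    have jp: "p \<le> j"
    proof (rule ccontr)
      assume "\<not> p \<le> j"
      then have "departure c T a s j = T"
        using clock_initial[of c j] s_less[of j] assms(1) by (simp add: departure_def)
      then show False using False dep t by simp
    qed
    then have "clock c T a s' j ! 0 \<le> a j"
      using agree[OF jp j] dep s_eq[OF jp] by (simp add: departure_def)
    then have "clock c' T a s j ! 0 \<le> a j" "clock c' T a s' j ! 0 \<le> a j"
      using clock_hd_le[of c c' j s s' T a] clock_hd_le[of c c' j s' s' T a] assms(1,2) s_le
      by fastforce+
    then show ?thesis using s_eq[OF jp] by (simp add: departure_def max_absorb2)
  qed
  then have "sum_list (drain t (clock c' T a s n)) = sum_list (drain t (clock c' T a s' n))"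
    using sum_list_drain_clock[of c' n s T a t] sum_list_drain_clock[of c' n s' T a t]
      c' idles s_nonneg s'_nonneg by simp
  then show ?thesis
    unfolding coalesced_def using drain_clock_eqI c' s_le by simp
qed

text \<open>With every upper server busy beyond \<open>t\<close> no entry would be clipped, so the
  clock vectors themselves would be equal and coalescence would hold at every \<open>u\<close>.
  Taking the last arrival for \<open>u\<close> detects coalescence caused by draining.\<close>

lemma idle_if_coalesced:
  assumes "1 \<le> c" "coalesced c n t" "\<not> coalesced c n u"
  shows "clock c T a s' n ! 0 \<le> t"
proof (rule ccontr)
  assume "\<not> ?thesis"
  then have pos: "t < clock c T a s' n ! k" if "k < c" for k
    using sorted_nth_mono[OF sorted_clock, of 0 k c T a s' n] that assms(1) by simp
  have "clock c T a s n = clock c T a s' n"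
  proof (rule nth_equalityI)
    fix k assume "k < length (clock c T a s n)"
    then have k: "k < c" using assms(1) by simp
    have "drain t (clock c T a s n) ! k = drain t (clock c T a s' n) ! k"
      using assms(2) by (simp add: coalesced_def)
    then show "clock c T a s n ! k = clock c T a s' n ! k"
      using k pos[OF k] assms(1) by (auto simp: drain_nth max_def split: if_splits)
  qed (use assms(1) in simp)
  then show False using assms(3) by (simp add: coalesced_def)
qed

text \<open>Look at the last arrival. If coalescence holds there, it held just before, and the
  induction hypothesis at that moment carries forward; otherwise draining caused it and a server is
  idle.\<close>

lemma coalesced_more_servers:
  assumes "1 \<le> c" "c \<le> c'" "p \<le> n" "coalesced c n t" "T \<le> t" "p < n \<Longrightarrow> a (n - 1) \<le> t"
    and agree: "\<And>j. p \<le> j \<Longrightarrow> j < n \<Longrightarrow> \<not> coalesced c j (a j) \<Longrightarrow>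
      max (clock c T a s j ! 0) (a j) = max (clock c T a s' j ! 0) (a j) \<Longrightarrow>
      clock c T a s' j ! 0 \<le> a j"
  shows "coalesced c' n t"
  using assms(3-)
proof (induction arbitrary: t rule: dec_induct)
  \<comment> \<open>With residual jobs only, the lower system is empty, so coalescence means that
    the upper one is empty too; \<open>agree\<close> has no instances here.\<close>
  case base
  have "drain t (clock c T a s' p) = drain t (replicate c T)"
    using base assms(1) clock_initial[of c p] by (simp add: coalesced_def)
  then have "drain t (clock c T a s' p) ! 0 = 0"
    using base(2) assms(1) by (simp add: drain_def)
  then have "clock c T a s' p ! 0 \<le> t"
    using assms(1) by (simp add: drain_nth)
  then show ?case
    using coalesced_more_servers_idle[OF assms(1,2)] base by simp
next
  case (step n)
  have an: "a n \<le> t" using step.prems(3) step.hyps(1) by simp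
  show ?case
  proof (cases "coalesced c (Suc n) (a n)")
    case True
    then have "coalesced c n (a n)" using coalesced_Suc_iff assms(1) step.hyps by simp
    then have "coalesced c' n (a n)"
    proof (rule step.IH[OF _ a_ge])
      show "a (n - 1) \<le> a n" using a_mono by (simp add: monoD)
      show "clock c T a s' j ! 0 \<le> a j"
        if "p \<le> j" "j < n" "\<not> coalesced c j (a j)"
          "max (clock c T a s j ! 0) (a j) = max (clock c T a s' j ! 0) (a j)" for j
        using step.prems(4)[OF that(1) _ that(3,4)] that(2) by simp
    qed
    then have "coalesced c' (Suc n) (a n)"
      using coalesced_Suc_iff[of c' n] assms(1,2) step.hyps by simp
    then show ?thesis using an coalesced_mono by blast
  next
    case False
    \<comment> \<open>Coalescence just before an earlier job would persist to \<open>a n\<close>, so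
      every job meets the guard of \<open>agree\<close>.\<close>
    have no: "\<not> coalesced c j (a j)" if "p \<le> j" "j < Suc n" for j
    proof
      assume "coalesced c j (a j)"
      then have "coalesced c (Suc n) (a n)"
        using coalesced_later[of c j "Suc n" "a j" "a n"] that a_mono assms(1) by (simp add: monoD)
      then show False using False by simp
    qed
    show ?thesis
    proof (rule coalesced_more_servers_idle[OF assms(1,2) step.prems(1) _ step.prems(2)])
      show "clock c T a s' (Suc n) ! 0 \<le> t"
        using idle_if_coalesced assms(1) step.prems(1) False by blast
      show "clock c T a s' j ! 0 \<le> a j"
        if "p \<le> j" "j < Suc n"
          "max (clock c T a s j ! 0) (a j) = max (clock c T a s' j ! 0) (a j)" for j
        using step.prems(4)[OF that(1,2) no[OF that(1,2)] that(3)] .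
    qed
  qed
qed

end

section \<open>Workload processes as clock vectors\<close>

lemma fcfs_process_eq_clock:
  fixes \<tau> S :: "nat \<Rightarrow> real"
  assumes c: "1 \<le> c" and T: "T < 0"
    and proc: "fcfs_process c T N \<tau> S (drain T (clock c T a s p)) V"
    and mono: "strict_mono_on {1..N} \<tau>" and win: "\<forall>i\<in>{1..N}. T < \<tau> i \<and> \<tau> i \<le> 0"
    and jobs: "\<And>i. i < N \<Longrightarrow> a (p + i) = \<tau> (Suc i) \<and> s (p + i) = S (Suc i) \<and> 0 \<le> S (Suc i)"
    and n: "n \<le> N"
  shows fcfs_process_left_limit:
      "n < N \<Longrightarrow> left_limit c V (\<tau> (Suc n)) = drain (\<tau> (Suc n)) (clock c T a s (p + n))"
    and fcfs_process_at: "\<lbrakk>n = 0 \<or> \<tau> n \<le> t; T \<le> t; t \<le> 0; n < N \<Longrightarrow> t < \<tau> (Suc n)\<rbrakk>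
      \<Longrightarrow> V t = drain t (clock c T a s (p + n))"
proof -
  \<comment> \<open>\<open>e n\<close> is the left end of the interval on which exactly the first
    \<open>n\<close> arrivals have occurred; \<open>T\<close> acts as arrival 0.\<close>
  define e where "e n = (if n = 0 then T else \<tau> n)" for n
  note fcfs = proc[unfolded fcfs_process_def]
  have VT: "V T = drain T (clock c T a s p)"
    using fcfs by (elim conjE)
  have len: "length (V t) = c" if "T \<le> t" "t \<le> 0" for t
    using fcfs that by (meson atLeastAtMost_iff)
  have drn: "V t = drain (t - s) (V s)"
    if "T \<le> s" "s \<le> t" "t \<le> 0" "\<forall>i\<in>{1..N}. \<tau> i \<notin> {s<..t}" for s t
    using fcfs that by blast
  have arr: "V (\<tau> i) = add_job (S i) (left_limit c V (\<tau> i))" if "i \<in> {1..N}" for i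
    using fcfs that by blast
  have e_win: "T \<le> e n" "e n \<le> 0" if "n \<le> N" for n
    using win T that by (auto simp: e_def less_imp_le)
  have e_less: "e n < \<tau> (Suc n)" if "n < N" for n
    using win strict_mono_onD[OF mono, of n "Suc n"] that by (auto simp: e_def)
  have seg: "V t = drain (t - e n) (V (e n))"
    if "n \<le> N" "e n \<le> t" "t \<le> 0" "n < N \<Longrightarrow> t < \<tau> (Suc n)" for n t
  proof (rule drn)
    show "\<forall>i\<in>{1..N}. \<tau> i \<notin> {e n<..t}"
    proof
      fix i assume i: "i \<in> {1..N}"
      show "\<tau> i \<notin> {e n<..t}"
      proof (cases "i \<le> n")
        case True
        then have "\<tau> i \<le> e n"
          using strict_mono_on_leD[OF mono, of i n] i that(1) by (auto simp: e_def)
        then show ?thesis by simp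
      next
        case False
        then have "\<tau> (Suc n) \<le> \<tau> i"
          using strict_mono_on_leD[OF mono, of "Suc n" i] i by simp
        then show ?thesis using that(4) False i by auto
      qed
    qed
  qed (use that e_win in auto)
  have lim: "left_limit c V (\<tau> (Suc n)) = drain (\<tau> (Suc n)) (clock c T a s (p + n))"
    if "n < N" and V: "V (e n) = drain (e n) (clock c T a s (p + n))" for n
  proof -
    have "\<tau> (Suc n) \<le> 0" using win that(1) by simp
    have "left_limit c V (\<tau> (Suc n)) = drain (\<tau> (Suc n) - e n) (V (e n))"
    proof (rule left_limit_drain)
      show "e n < \<tau> (Suc n)" using e_less[OF that(1)] .
      show "length (V (e n)) = c" using len[OF e_win] that(1) by simp
      show "V t = drain (t - e n) (V (e n))" if "e n \<le> t" "t < \<tau> (Suc n)" for t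
        by (rule seg) (use that \<open>n < N\<close> \<open>\<tau> (Suc n) \<le> 0\<close> in simp_all)
    qed
    also have "\<dots> = drain (\<tau> (Suc n)) (clock c T a s (p + n))"
      unfolding V by (rule drain_diff) (use e_less[OF that(1)] in simp)
    finally show ?thesis .
  qed
  have at: "V (e n) = drain (e n) (clock c T a s (p + n))" if "n \<le> N" for n
    using that
  proof (induction n)
    case 0
    then show ?case by (simp add: VT e_def)
  next
    case (Suc n)
    then have "left_limit c V (\<tau> (Suc n)) = drain (\<tau> (Suc n)) (clock c T a s (p + n))"
      using lim by simp
    then show ?case
      using arr[of "Suc n"] jobs[of n] add_job_drain[OF c, of s "p + n" a T] Suc.prems
      by (simp add: e_def)
  qed
  show "left_limit c V (\<tau> (Suc n)) = drain (\<tau> (Suc n)) (clock c T a s (p + n))" if "n < N"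
    using lim at that by simp
  show "V t = drain t (clock c T a s (p + n))"
    if "n = 0 \<or> \<tau> n \<le> t" "T \<le> t" "t \<le> 0" "n < N \<Longrightarrow> t < \<tau> (Suc n)"
  proof -
    have e: "e n \<le> t" using that by (auto simp: e_def)
    have "V t = drain (t - e n) (V (e n))"
      by (rule seg[OF n e that(3,4)])
    also have "\<dots> = drain t (clock c T a s (p + n))"
      unfolding at[OF n] by (rule drain_diff[OF e])
    finally show ?thesis .
  qed
qed

lemma difference_eq_zero_iff:
  assumes "length (U t) = c" "length (L t) = c"
  shows "difference U L t = replicate c 0 \<longleftrightarrow> L t = U t"
proof -
  have "difference U L t = replicate c 0 \<longleftrightarrow> (\<forall>k<c. U t ! k - L t ! k = 0)"
    using assms by (auto simp: difference_def list_eq_iff_nth_eq)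
  also have "\<dots> \<longleftrightarrow> L t = U t"
    using assms by (auto simp: list_eq_iff_nth_eq)
  finally show ?thesis .
qed

lemma upper_init_eq_clock:
  assumes "1 \<le> c" "\<And>j. j < length r \<Longrightarrow> a j = T \<and> s j = r ! j \<and> 0 \<le> r ! j"
  shows "upper_init c r = drain T (clock c T a s (length r))"
  using assms(2)
proof (induction r rule: rev_induct)
  case Nil
  then show ?case by (simp add: upper_init_def drain_def)
next
  case (snoc x r)
  have "upper_init c r = drain T (clock c T a s (length r))"
  proof (rule snoc.IH)
    show "a j = T \<and> s j = r ! j \<and> 0 \<le> r ! j" if "j < length r" for j
      using snoc.prems[of j] that by (simp add: nth_append)
  qed
  moreover have "upper_init c (r @ [x]) = add_job x (upper_init c r)"
    by (simp add: upper_init_def)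
  ultimately show ?case
    using add_job_drain[OF assms(1), of s "length r" a T] snoc.prems[of "length r"]
    by (simp add: nth_append)
qed

theorem theorem6:
  fixes c N :: nat and T :: real and r :: "real list"
    and \<tau> S :: "nat \<Rightarrow> real"
    and U L :: "nat \<Rightarrow> real \<Rightarrow> real list"
  assumes "c \<ge> 1" and "T < 0"
    and residuals: "\<forall>x\<in>set r. 0 < x"
    and arrivals: "strict_mono_on {1..N} \<tau>" "\<forall>i\<in>{1..N}. T < \<tau> i \<and> \<tau> i \<le> 0"
    and services: "\<forall>i\<in>{1..N}. 0 < S i"
    and lower: "\<forall>c'\<ge>c. fcfs_process c' T N \<tau> S (lower_init c') (L c')"
    and upper: "\<forall>c'\<ge>c. fcfs_process c' T N \<tau> S (upper_init c' r) (U c')"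
    and coalesce: "coalescence_time c T (U c) (L c) < 0"
    and agreement: "\<forall>i\<in>{1..N}.
      ereal (\<tau> i) \<in> {ereal T..coalescence_time c T (U c) (L c)} \<longrightarrow>
      left_limit c (L c) (\<tau> i) ! 0 = left_limit c (U c) (\<tau> i) ! 0 \<longrightarrow>
      left_limit c (U c) (\<tau> i) ! 0 = 0"
  shows "\<forall>m::nat. coalescence_time (c + m) T (U (c + m)) (L (c + m))
                    \<le> coalescence_time c T (U c) (L c)"
proof
  fix m :: nat
  define p where "p = length r"
  \<comment> \<open>Jobs are counted from 0: the residuals come first, all at \<open>T\<close>, and
    arrival \<open>Suc i\<close> is job \<open>p + i\<close>. From \<open>p + N\<close> on the
    values are dummies; time 0 keeps \<open>a\<close> monotone because every arrival time is at most
    0.\<close>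
  define a where "a j = (if j < p then T else if j - p < N then \<tau> (Suc (j - p)) else 0)" for j
  define s' where "s' j = (if j < p then r ! j else if j - p < N then S (Suc (j - p)) else 0)" for j
  define s where "s j = (if j < p then 0 else s' j)" for j
  interpret coupled_jobs T a s s' p
  proof
    show "T \<le> a j" for j using arrivals(2) \<open>T < 0\<close> by (simp add: a_def less_imp_le)
    show "mono a"
    proof (rule monoI)
      fix i j :: nat assume "i \<le> j"
      then show "a i \<le> a j"
        using arrivals(2) \<open>T < 0\<close> strict_mono_on_leD[OF arrivals(1), of "Suc (i - p)" "Suc (j - p)"]
        by (auto simp: a_def less_imp_le)
    qed
    show "0 \<le> s j" for j using services by (simp add: s_def s'_def less_imp_le)
    show "a j = T \<and> s j = 0 \<and> 0 < s' j" if "j < p" for j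
      using that residuals by (simp add: a_def s_def s'_def p_def)
  qed (simp add: s_def)
  have jobs: "a (p + i) = \<tau> (Suc i) \<and> s (p + i) = S (Suc i) \<and> 0 \<le> S (Suc i)"
      "a (p + i) = \<tau> (Suc i) \<and> s' (p + i) = S (Suc i) \<and> 0 \<le> S (Suc i)" if "i < N" for i
    using that services by (auto simp: a_def s_def s'_def less_imp_le)
  have Lp: "fcfs_process c' T N \<tau> S (drain T (clock c' T a s p)) (L c')" if "c \<le> c'" for c'
    using lower that clock_initial[of c' p] \<open>c \<ge> 1\<close> by (simp add: lower_init_def drain_def)
  have Up: "fcfs_process c' T N \<tau> S (drain T (clock c' T a s' p)) (U c')" if "c \<le> c'" for c'
  proof -
    have "upper_init c' r = drain T (clock c' T a s' p)"
      unfolding p_def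
      by (rule upper_init_eq_clock)
        (use that \<open>c \<ge> 1\<close> residuals in \<open>auto simp: a_def s'_def p_def less_imp_le\<close>)
    then show ?thesis using upper[rule_format, OF that] by simp
  qed
  define C where "C c' = {t. T < t \<and> t \<le> 0 \<and> difference (U c') (L c') t = replicate c' 0}" for c'
  have time: "coalescence_time c' T (U c') (L c') = Inf (ereal ` C c')" for c'
    by (simp add: coalescence_time_def C_def)
  have C_iff: "t \<in> C c' \<longleftrightarrow> coalesced c' (p + n) t"
    if "c \<le> c'" "T < t" "t \<le> 0" "n \<le> N" "n = 0 \<or> \<tau> n \<le> t" "n < N \<Longrightarrow> t < \<tau> (Suc n)" for c' n t
  proof -
    have "1 \<le> c'" using that(1) \<open>c \<ge> 1\<close> by simp
    then have "L c' t = drain t (clock c' T a s (p + n))" "U c' t = drain t (clock c' T a s' (p + n))"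
      using fcfs_process_at[OF _ \<open>T < 0\<close> Lp arrivals jobs(1), of c' n t]
        fcfs_process_at[OF _ \<open>T < 0\<close> Up arrivals jobs(2), of c' n t] that by auto
    then show ?thesis
      using difference_eq_zero_iff[of "U c'" t c' "L c'"] that \<open>1 \<le> c'\<close>
      by (simp add: C_def coalesced_def)
  qed
  have window: "\<exists>n\<le>N. (n = 0 \<or> \<tau> n \<le> t) \<and> (n < N \<longrightarrow> t < \<tau> (Suc n))" for t
  proof -
    define n where "n = (GREATEST n. n \<le> N \<and> (n = 0 \<or> \<tau> n \<le> t))"
    have "n \<le> N \<and> (n = 0 \<or> \<tau> n \<le> t)"
      unfolding n_def by (rule GreatestI_nat[of _ 0 N]) auto
    moreover have "t < \<tau> (Suc n)" if "n < N"
    proof (rule ccontr)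
      assume "\<not> t < \<tau> (Suc n)"
      then have "Suc n \<le> n"
        unfolding n_def using that n_def by (intro Greatest_le_nat[of _ _ N]) auto
      then show False by simp
    qed
    ultimately show ?thesis by blast
  qed
  have agree: "clock c T a s' j ! 0 \<le> a j"
    if j: "p \<le> j" "j < p + N" and not: "\<not> coalesced c j (a j)"
      and eq: "max (clock c T a s j ! 0) (a j) = max (clock c T a s' j ! 0) (a j)" for j
  proof -
    define i where "i = j - p"
    have i: "j = p + i" "i < N" "a j = \<tau> (Suc i)" using j by (auto simp: i_def a_def)
    \<comment> \<open>A coalescence before this arrival would persist up to it, against
      \<open>not\<close>. Hence the arrival time is a lower bound of \<open>C c\<close>, so it is at
      most the infimum and falls in the range of the agreement hypothesis.\<close>
    have "\<tau> (Suc i) \<le> t" if t: "t \<in> C c" for t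
    proof (rule ccontr)
      assume less: "\<not> \<tau> (Suc i) \<le> t"
      have t': "T < t" "t \<le> 0" using t by (auto simp: C_def)
      obtain n where n: "n \<le> N" "n = 0 \<or> \<tau> n \<le> t" "n < N \<longrightarrow> t < \<tau> (Suc n)"
        using window by blast
      have co: "coalesced c (p + n) t" using C_iff[of c t n] n t t' by simp
      have "n \<le> i"
        using strict_mono_on_leD[OF arrivals(1), of "Suc i" n] n less i(2) by force
      then have "coalesced c j (a j)"
        using coalesced_later[of c "p + n" j t "a j"] \<open>c \<ge> 1\<close> co less i jobs(1)[of n] n(3) a_mono
        by (simp add: monoD)
      then show False using not by simp
    qed
    then have "ereal (\<tau> (Suc i)) \<le> coalescence_time c T (U c) (L c)"
      unfolding time by (auto intro: Inf_greatest)
    moreover have "left_limit c (L c) (\<tau> (Suc i)) = drain (a j) (clock c T a s j)"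
        "left_limit c (U c) (\<tau> (Suc i)) = drain (a j) (clock c T a s' j)"
      using fcfs_process_left_limit[OF \<open>c \<ge> 1\<close> \<open>T < 0\<close> Lp arrivals jobs(1), of i]
        fcfs_process_left_limit[OF \<open>c \<ge> 1\<close> \<open>T < 0\<close> Up arrivals jobs(2), of i] i by auto
    \<comment> \<open>Equal service starts are equal first coordinates, since
      \<open>max (x - a j) 0 = max x (a j) - a j\<close>.\<close>
    moreover have "drain (a j) (clock c T a s j) ! 0 = drain (a j) (clock c T a s' j) ! 0"
      using eq \<open>c \<ge> 1\<close> by (auto simp: drain_nth max_def split: if_splits)
    ultimately have "drain (a j) (clock c T a s' j) ! 0 = 0"
      using agreement i(2) arrivals(2) by (auto simp: less_imp_le)
    then show ?thesis using \<open>c \<ge> 1\<close> by (simp add: drain_nth)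
  qed
  \<comment> \<open>Comparing the whole sets avoids asking whether either infimum is
    attained.\<close>
  have "C c \<subseteq> C (c + m)"
  proof
    fix t assume t: "t \<in> C c"
    then have t': "T < t" "t \<le> 0" by (auto simp: C_def)
    obtain n where n: "n \<le> N" "n = 0 \<or> \<tau> n \<le> t" "n < N \<longrightarrow> t < \<tau> (Suc n)"
      using window by blast
    have "coalesced (c + m) (p + n) t"
    proof (rule coalesced_more_servers[OF \<open>c \<ge> 1\<close>])
      show "coalesced c (p + n) t" using C_iff[of c t n] n t t' by simp
      show "a (p + n - 1) \<le> t" if "p < p + n" using jobs(1)[of "n - 1"] n that by simp
      show "clock c T a s' j ! 0 \<le> a j"
        if "p \<le> j" "j < p + n" "\<not> coalesced c j (a j)"
          "max (clock c T a s j ! 0) (a j) = max (clock c T a s' j ! 0) (a j)" for j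
        using agree[OF that(1) _ that(3,4)] that(2) n(1) by simp
    qed (use t' in auto)
    then show "t \<in> C (c + m)" using C_iff[of "c + m" t n] n t' by simp
  qed
  then show "coalescence_time (c + m) T (U (c + m)) (L (c + m)) \<le> coalescence_time c T (U c) (L c)"
    unfolding time by (intro Inf_superset_mono image_mono)
qed

end
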